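(* Let $(T^*Q,\omega,H)$ be a Hamiltonian system with dynamical vector field $X_H$. Let $\gamma: Q\to T^*Q$ be a one-form on $Q$, let $\lambda=\gamma\circ\pi_Q: T^*Q\to T^*Q$, let $\varepsilon: T^*Q\to T^*Q$ be any symplectic map, and put $X_H^\varepsilon=T\pi_Q\circ X_H\circ\varepsilon: T^*Q\to TQ$. Let $X_{H\circ\varepsilon}$ be the Hamiltonian vector field on $T^*Q$ of the function $H\circ\varepsilon: T^*Q\to\mathbb{R}$. Then $\varepsilon$ is a solution of the equation $$T\varepsilon\circ X_{H\circ\varepsilon}=T\lambda\circ X_H\circ\varepsilon$$ if and only if it is a solution of the equation $$T\gamma\circ X_H^\varepsilon=X_H\circ\varepsilon$$ (both being equalities of maps $T^*Q\to TT^*Q$). The second equation is called the Type II Hamilton-Jacobi equation for $(T^*Q,\omega,H)$.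
   Context: All manifolds are real, smooth and finite dimensional. $Q$ is a smooth manifold, $\pi_Q: T^*Q\to Q$ the cotangent bundle projection, $\omega$ the canonical symplectic form on $T^*Q$, $H: T^*Q\to\mathbb{R}$ a smooth function (the Hamiltonian), and the dynamical vector field $X_H$ is the Hamiltonian vector field of $H$, determined by $\mathbf{i}_{X_H}\omega=\mathbf{d}H$. A one-form on $Q$ is identified with a section $\gamma: Q\to T^*Q$ of $\pi_Q$. A symplectic map $\varepsilon$ is a smooth map with $\varepsilon^*\omega=\omega$. *)

theory Defs
  imports "HOL-Analysis.Analysis"
begin

text \<open>
  On an open subset of a finite-dimensional space, being \<open>C\<^sup>k\<^sup>+\<^sup>1\<close> means being differentiable with
  all directional derivatives \<open>C\<^sup>k\<close>. Iterating directional derivatives keeps the codomain type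
  fixed, so that the recursion is typable.
\<close>

primrec Ck_on :: "nat \<Rightarrow> 'e::real_normed_vector set \<Rightarrow> ('e \<Rightarrow> 'f::real_normed_vector) \<Rightarrow> bool" where
  "Ck_on 0 S f \<longleftrightarrow> continuous_on S f"
| "Ck_on (Suc k) S f \<longleftrightarrow> (\<forall>x\<in>S. f differentiable at x) \<and>
     (\<forall>u. Ck_on k S (\<lambda>x. frechet_derivative f (at x) u))"

definition smooth_on :: "'e::real_normed_vector set \<Rightarrow> ('e \<Rightarrow> 'f::real_normed_vector) \<Rightarrow> bool" where
  "smooth_on S f \<longleftrightarrow> (\<forall>k. Ck_on k S f)"

text \<open>
  A manifold is given by its atlas: the underlying set is the union of the chart domains, and the
  topology is the one induced by the charts. A chart is a pair of its domain and its coordinate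
  map; the values of the coordinate map outside the domain are irrelevant. The model space is a
  finite-dimensional normed space (and not of class \<open>euclidean_space\<close>, which would exclude
  dimension 0).
\<close>

type_synonym ('a, 'e) chart = "'a set \<times> ('a \<Rightarrow> 'e)"
type_synonym ('a, 'e) atlas = "('a, 'e) chart set"

definition chart_inv :: "('a, 'e) chart \<Rightarrow> 'e \<Rightarrow> 'a" where
  "chart_inv c = inv_into (fst c) (snd c)"

definition points :: "('a, 'e) atlas \<Rightarrow> 'a set" where
  "points A = (\<Union>c\<in>A. fst c)"

definition local_rep :: "('a, 'e) chart \<Rightarrow> ('b, 'f) chart \<Rightarrow> ('a \<Rightarrow> 'b) \<Rightarrow> 'e \<Rightarrow> 'f" where
  "local_rep c d f = snd d \<circ> f \<circ> chart_inv c"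

definition smooth_atlas :: "('a, 'e::real_normed_vector) atlas \<Rightarrow> bool" where
  "smooth_atlas A \<longleftrightarrow>
     (\<forall>c\<in>A. inj_on (snd c) (fst c)) \<and>
     (\<forall>c\<in>A. \<forall>d\<in>A. open (snd c ` (fst c \<inter> fst d)) \<and>
        smooth_on (snd c ` (fst c \<inter> fst d)) (local_rep c d id))"

definition manifold_topology :: "('a, 'e::real_normed_vector) atlas \<Rightarrow> 'a topology" where
  "manifold_topology A =
     topology (\<lambda>W. W \<subseteq> points A \<and> (\<forall>c\<in>A. open (snd c ` (fst c \<inter> W))))"

lemma openin_manifold_topology:
  assumes "smooth_atlas A"
  shows "openin (manifold_topology A) W \<longleftrightarrow>
    W \<subseteq> points A \<and> (\<forall>c\<in>A. open (snd c ` (fst c \<inter> W)))"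
proof -
  have "istopology (\<lambda>W. W \<subseteq> points A \<and> (\<forall>c\<in>A. open (snd c ` (fst c \<inter> W))))"
    unfolding istopology_def
  proof (intro conjI allI impI ballI)
    fix S T c
    assume S: "S \<subseteq> points A \<and> (\<forall>c\<in>A. open (snd c ` (fst c \<inter> S)))"
      and T: "T \<subseteq> points A \<and> (\<forall>c\<in>A. open (snd c ` (fst c \<inter> T)))" and c: "c \<in> A"
    have "inj_on (snd c) (fst c)"
      using assms c by (auto simp: smooth_atlas_def)
    then have "snd c ` ((fst c \<inter> S) \<inter> (fst c \<inter> T)) = snd c ` (fst c \<inter> S) \<inter> snd c ` (fst c \<inter> T)"
      by (intro inj_on_image_Int) auto
    moreover have "(fst c \<inter> S) \<inter> (fst c \<inter> T) = fst c \<inter> (S \<inter> T)" by auto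
    ultimately show "open (snd c ` (fst c \<inter> (S \<inter> T)))"
      using S T c by (metis open_Int)
  next
    fix K c
    assume K: "\<forall>S\<in>K. S \<subseteq> points A \<and> (\<forall>c\<in>A. open (snd c ` (fst c \<inter> S)))" and c: "c \<in> A"
    have "snd c ` (fst c \<inter> \<Union>K) = (\<Union>S\<in>K. snd c ` (fst c \<inter> S))" by auto
    then show "open (snd c ` (fst c \<inter> \<Union>K))" using K c by auto
  qed auto
  then show ?thesis
    by (simp add: manifold_topology_def)
qed

definition smooth_manifold :: "('a, 'e::real_normed_vector) atlas \<Rightarrow> bool" where
  "smooth_manifold A \<longleftrightarrow>
     (\<exists>B :: 'e set. finite B \<and> span B = UNIV) \<and>
     smooth_atlas A \<and>
     Hausdorff_space (manifold_topology A) \<and> second_countable (manifold_topology A)"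

definition smooth_map ::
  "('a, 'e::real_normed_vector) atlas \<Rightarrow> ('b, 'f::real_normed_vector) atlas \<Rightarrow> ('a \<Rightarrow> 'b) \<Rightarrow> bool" where
  "smooth_map A B f \<longleftrightarrow>
     continuous_map (manifold_topology A) (manifold_topology B) f \<and>
     (\<forall>c\<in>A. \<forall>d\<in>B. smooth_on (snd c ` (fst c \<inter> f -` fst d)) (local_rep c d f))"

definition real_line :: "(real, real) atlas" where
  "real_line = {(UNIV, id)}"

definition chart_at :: "('a, 'e) atlas \<Rightarrow> 'a \<Rightarrow> ('a, 'e) chart" where
  "chart_at A p = (SOME c. c \<in> A \<and> p \<in> fst c)"

text \<open>
  A tangent vector at \<open>p\<close> is represented by the family of its coordinate vectors in all the charts
  around \<open>p\<close>, which transform by the derivatives of the transition maps (the family is zero at all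
  other indices). The linear structure is pointwise. Elements of the tangent bundle are pairs of a
  base point and a tangent vector there, so equality of elements includes equality of base points.
\<close>

type_synonym ('a, 'e) tangent = "('a, 'e) chart \<Rightarrow> 'e"

definition tangent_space :: "('a, 'e::real_normed_vector) atlas \<Rightarrow> 'a \<Rightarrow> ('a, 'e) tangent set" where
  "tangent_space A p = {v.
     (\<forall>c. \<not> (c \<in> A \<and> p \<in> fst c) \<longrightarrow> v c = 0) \<and>
     (\<forall>c\<in>A. \<forall>d\<in>A. p \<in> fst c \<inter> fst d \<longrightarrow>
        v d = frechet_derivative (local_rep c d id) (at (snd c p)) (v c))}"

definition tangent_vector ::
  "('a, 'e::real_normed_vector) atlas \<Rightarrow> 'a \<Rightarrow> ('a, 'e) chart \<Rightarrow> 'e \<Rightarrow> ('a, 'e) tangent" where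
  "tangent_vector A p c u = (\<lambda>d. if d \<in> A \<and> p \<in> fst d
     then frechet_derivative (local_rep c d id) (at (snd c p)) u else 0)"

text \<open>
  The tangent map \<open>T f\<close> and the differential of a real function, computed in an arbitrary chart
  around the base point; by the chain rule the choice of the chart does not matter for smooth \<open>f\<close>.
\<close>

definition tangent_map ::
  "('a, 'e::real_normed_vector) atlas \<Rightarrow> ('b, 'f::real_normed_vector) atlas \<Rightarrow> ('a \<Rightarrow> 'b) \<Rightarrow>
   'a \<times> ('a, 'e) tangent \<Rightarrow> 'b \<times> ('b, 'f) tangent" where
  "tangent_map A B f = (\<lambda>(p, v). (f p, \<lambda>d. if d \<in> B \<and> f p \<in> fst d
     then frechet_derivative (local_rep (chart_at A p) d f) (at (snd (chart_at A p) p))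
            (v (chart_at A p))
     else 0))"

definition differential ::
  "('a, 'e::real_normed_vector) atlas \<Rightarrow> ('a \<Rightarrow> real) \<Rightarrow> 'a \<Rightarrow> ('a, 'e) tangent \<Rightarrow> real" where
  "differential A f p v =
     (let c = chart_at A p in frechet_derivative (f \<circ> chart_inv c) (at (snd c p)) (v c))"

text \<open>
  The exterior derivative of a one-form: in a chart with local representative
  \<open>\<theta>\<^sub>c(x) \<in> E\<^sup>*\<close>, \<open>d\<theta>(v, w) = D\<theta>\<^sub>c(x)(v)(w) - D\<theta>\<^sub>c(x)(w)(v)\<close>. For smooth \<open>\<theta>\<close> the value does
  not depend on the chart.
\<close>

definition exterior_deriv ::
  "('a, 'e::real_normed_vector) atlas \<Rightarrow> ('a \<Rightarrow> ('a, 'e) tangent \<Rightarrow> real) \<Rightarrow>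
   'a \<Rightarrow> ('a, 'e) tangent \<Rightarrow> ('a, 'e) tangent \<Rightarrow> real" where
  "exterior_deriv A \<theta> p v w =
     (let c = chart_at A p;
          \<theta>\<^sub>c = (\<lambda>x u. \<theta> (chart_inv c x) (tangent_vector A (chart_inv c x) c u))
      in frechet_derivative (\<lambda>x. \<theta>\<^sub>c x (w c)) (at (snd c p)) (v c)
       - frechet_derivative (\<lambda>x. \<theta>\<^sub>c x (v c)) (at (snd c p)) (w c))"

definition pullback_form ::
  "('a, 'e::real_normed_vector) atlas \<Rightarrow> ('b, 'f::real_normed_vector) atlas \<Rightarrow> ('a \<Rightarrow> 'b) \<Rightarrow>
   ('b \<Rightarrow> ('b, 'f) tangent \<Rightarrow> ('b, 'f) tangent \<Rightarrow> real) \<Rightarrow>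
   'a \<Rightarrow> ('a, 'e) tangent \<Rightarrow> ('a, 'e) tangent \<Rightarrow> real" where
  "pullback_form A B f \<omega> p v w =
     \<omega> (f p) (snd (tangent_map A B f (p, v))) (snd (tangent_map A B f (p, w)))"

text \<open>
  The cotangent space is the dual of the tangent space; functionals are extended by 0 outside the
  tangent space to make them unique as HOL functions. (Continuity is automatic in finite dimension.)
\<close>

type_synonym ('a, 'e) covector = "'a \<times> (('a, 'e) tangent \<Rightarrow> real)"
type_synonym ('a, 'e) cotangent_tangent =
  "(('a, 'e) covector, 'e \<times> ('e \<Rightarrow>\<^sub>L real)) tangent"

definition cotangent_space ::
  "('a, 'e::real_normed_vector) atlas \<Rightarrow> 'a \<Rightarrow> (('a, 'e) tangent \<Rightarrow> real) set" where
  "cotangent_space A q = {\<alpha>.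
     (\<forall>v. v \<notin> tangent_space A q \<longrightarrow> \<alpha> v = 0) \<and>
     (\<forall>v\<in>tangent_space A q. \<forall>w\<in>tangent_space A q. \<alpha> (\<lambda>c. v c + w c) = \<alpha> v + \<alpha> w) \<and>
     (\<forall>r. \<forall>v\<in>tangent_space A q. \<alpha> (\<lambda>c. r *\<^sub>R v c) = r * \<alpha> v)}"

definition cotangent_chart ::
  "('a, 'e::real_normed_vector) atlas \<Rightarrow> ('a, 'e) chart \<Rightarrow>
   (('a, 'e) covector, 'e \<times> ('e \<Rightarrow>\<^sub>L real)) chart" where
  "cotangent_chart A c =
     (Sigma (fst c) (cotangent_space A),
      \<lambda>(q, \<alpha>). (snd c q, Blinfun (\<lambda>u. \<alpha> (tangent_vector A q c u))))"

definition cotangent_bundle ::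
  "('a, 'e::real_normed_vector) atlas \<Rightarrow> (('a, 'e) covector, 'e \<times> ('e \<Rightarrow>\<^sub>L real)) atlas" where
  "cotangent_bundle A = cotangent_chart A ` A"

definition cotangent_proj :: "('a, 'e) covector \<Rightarrow> 'a" where
  "cotangent_proj = fst"

definition one_form ::
  "('a, 'e::real_normed_vector) atlas \<Rightarrow> ('a \<Rightarrow> ('a, 'e) covector) \<Rightarrow> bool" where
  "one_form A \<gamma> \<longleftrightarrow> smooth_map A (cotangent_bundle A) \<gamma> \<and>
     (\<forall>q\<in>points A. cotangent_proj (\<gamma> q) = q)"

definition liouville_form ::
  "('a, 'e::real_normed_vector) atlas \<Rightarrow> ('a, 'e) covector \<Rightarrow> ('a, 'e) cotangent_tangent \<Rightarrow> real" where
  "liouville_form A z v =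
     snd z (snd (tangent_map (cotangent_bundle A) A cotangent_proj (z, v)))"

text \<open>
  Sign convention: \<open>\<omega> = -d\<theta> = dq\<^sup>i \<and> dp\<^sub>i\<close>, for which \<open>i\<^bsub>X\<^esub>\<omega> = dH\<close> gives Hamilton's equations.
\<close>

definition canonical_form ::
  "('a, 'e::real_normed_vector) atlas \<Rightarrow> ('a, 'e) covector \<Rightarrow>
   ('a, 'e) cotangent_tangent \<Rightarrow> ('a, 'e) cotangent_tangent \<Rightarrow> real" where
  "canonical_form A z v w = - exterior_deriv (cotangent_bundle A) (liouville_form A) z v w"

definition hamiltonian_vector_field ::
  "('a, 'e::real_normed_vector) atlas \<Rightarrow> (('a, 'e) covector \<Rightarrow> real) \<Rightarrow>
   ('a, 'e) covector \<Rightarrow> ('a, 'e) covector \<times> ('a, 'e) cotangent_tangent" where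
  "hamiltonian_vector_field A H z = (z, THE v. v \<in> tangent_space (cotangent_bundle A) z \<and>
     (\<forall>w\<in>tangent_space (cotangent_bundle A) z.
        canonical_form A z v w = differential (cotangent_bundle A) H z w))"

definition symplectic_map ::
  "('a, 'e::real_normed_vector) atlas \<Rightarrow> (('a, 'e) covector \<Rightarrow> ('a, 'e) covector) \<Rightarrow> bool" where
  "symplectic_map A \<epsilon> \<longleftrightarrow>
     smooth_map (cotangent_bundle A) (cotangent_bundle A) \<epsilon> \<and>
     (\<forall>z\<in>points (cotangent_bundle A).
      \<forall>v\<in>tangent_space (cotangent_bundle A) z. \<forall>w\<in>tangent_space (cotangent_bundle A) z.
        pullback_form (cotangent_bundle A) (cotangent_bundle A) \<epsilon> (canonical_form A) z v w
        = canonical_form A z v w)"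

end

theory Submission
  imports Defs
begin

text \<open>
  In a cotangent chart the canonical form is the constant form
  \<open>((x, a), (y, b)) \<mapsto> b x - a y\<close>, which is nondegenerate because the model space is
  finite-dimensional. Hence the derivative of a symplectic map \<open>\<epsilon>\<close> is injective, and bijective by
  dimension, so that \<open>T\<epsilon> \<circ> X\<^sub>H\<^sub>\<circ>\<^sub>\<epsilon> = X\<^sub>H \<circ> \<epsilon>\<close>. By the chain rule \<open>T\<lambda> = T\<gamma> \<circ> T\<pi>\<close>, and the two
  equations coincide side by side.
\<close>

section \<open>Finite-dimensional normed spaces\<close>

text \<open>The model space is known only to have a finite spanning set, so the finite-dimensional
  facts are drawn from a \<open>dual_frame\<close>: of a basis with its coordinate functionals only
  the reproducing identity is kept. It writes every linear map out of the model space as a finite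
  sum of bounded functionals times fixed vectors. Hence such maps are continuous, covectors pass
  through \<open>Blinfun\<close> unharmed, and differentiability of the cotangent transition maps
  reduces to finitely many real coefficients. Surjectivity of the derivative of \<epsilon> matters
  because the Hamiltonian vector at \<open>\<epsilon> z\<close> must be tested against all tangent
  vectors there, while invariance of the form only controls pairings of image vectors. Moreover,
  \<open>hamiltonian_vector_field\<close> is a definite description: nondegeneracy supplies
  uniqueness, and existence comes from an explicit solution.\<close>

text \<open>The lower bound makes the coefficients of a Cauchy sequence Cauchy themselves; their
  limits are coefficients of the limit.\<close>

lemma closed_span_coefficient_bound:
  fixes B :: "'v::real_normed_vector set"
  assumes "finite B" and "c > 0"
    and bound: "\<And>r. c * (\<Sum>b\<in>B. \<bar>r b\<bar>) \<le> norm (\<Sum>b\<in>B. r b *\<^sub>R b)"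
  shows "closed (span B)"
  unfolding closed_sequential_limits
proof (intro allI impI, elim conjE)
  fix y l assume y: "\<forall>n. y n \<in> span B" and lim: "y \<longlonglongrightarrow> l"
  have "\<exists>r. y n = (\<Sum>b\<in>B. r b *\<^sub>R b)" for n
    using y span_finite[OF \<open>finite B\<close>] by (metis (mono_tags, lifting) imageE)
  then obtain r where r: "y n = (\<Sum>b\<in>B. r n b *\<^sub>R b)" for n
    by metis
  have "Cauchy (\<lambda>n. r n b)" if b: "b \<in> B" for b
  proof (rule metric_CauchyI)
    fix e :: real assume "e > 0"
    then have "c * e > 0" using \<open>c > 0\<close> by simp
    with LIMSEQ_imp_Cauchy[OF lim] obtain M
      where M: "\<And>m n. m \<ge> M \<Longrightarrow> n \<ge> M \<Longrightarrow> dist (y m) (y n) < c * e"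
      by (meson metric_CauchyD)
    have "dist (r m b) (r n b) < e" if "m \<ge> M" "n \<ge> M" for m n
    proof -
      have "c * \<bar>r m b - r n b\<bar> \<le> c * (\<Sum>b\<in>B. \<bar>r m b - r n b\<bar>)"
        using \<open>c > 0\<close> b \<open>finite B\<close>
        by (intro mult_left_mono member_le_sum) auto
      also have "\<dots> \<le> norm (\<Sum>b\<in>B. (r m b - r n b) *\<^sub>R b)" by (rule bound)
      also have "\<dots> = dist (y m) (y n)"
        by (simp add: r dist_norm scaleR_left_diff_distrib sum_subtractf)
      also have "\<dots> < c * e" using M that by simp
      finally show ?thesis using \<open>c > 0\<close> by (simp add: dist_real_def)
    qed
    then show "\<exists>M. \<forall>m\<ge>M. \<forall>n\<ge>M. dist (r m b) (r n b) < e" by blast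
  qed
  then have "\<forall>b\<in>B. \<exists>s. (\<lambda>n. r n b) \<longlonglongrightarrow> s"
    by (simp add: Cauchy_convergent_iff convergent_def)
  then obtain s where s: "\<And>b. b \<in> B \<Longrightarrow> (\<lambda>n. r n b) \<longlonglongrightarrow> s b"
    by metis
  have "y \<longlonglongrightarrow> (\<Sum>b\<in>B. s b *\<^sub>R b)"
    unfolding r[abs_def] by (intro tendsto_intros s)
  then have "l = (\<Sum>b\<in>B. s b *\<^sub>R b)" using lim LIMSEQ_unique by blast
  then show "l \<in> span B" by (simp add: span_sum span_scale span_base)
qed

text \<open>Equivalence of norms in finite dimension, by induction on the basis instead of
  compactness: the smaller span is closed by the preceding lemma, so a new independent vector has
  positive distance from it.\<close>

lemma independent_coefficient_bound:
  fixes B :: "'v::real_normed_vector set"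
  assumes "finite B" "independent B"
  shows "\<exists>c>0. \<forall>r. c * (\<Sum>b\<in>B. \<bar>r b\<bar>) \<le> norm (\<Sum>b\<in>B. r b *\<^sub>R b)"
  using assms
proof (induction B)
  case empty
  show ?case by (intro exI[of _ 1]) simp
next
  case (insert a B)
  have aB: "a \<notin> span B" "independent B"
    using insert by (auto simp: independent_insert)
  obtain c where c: "c > 0"
    "\<And>r. c * (\<Sum>b\<in>B. \<bar>r b\<bar>) \<le> norm (\<Sum>b\<in>B. r b *\<^sub>R b)"
    using insert.IH[OF aB(2)] by blast
  have "open (- span B)"
    using closed_span_coefficient_bound[OF insert.hyps(1) c] by (simp add: open_Compl)
  then obtain d where d: "d > 0" "ball a d \<subseteq> - span B"
    using aB(1) by (meson ComplI open_contains_ball)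
  have far: "d * \<bar>t\<bar> \<le> norm (t *\<^sub>R a + s)" if s: "s \<in> span B" for t s
  proof (cases "t = 0")
    case False
    \<comment> \<open>Dividing by \<open>t\<close> moves the question to the ball around
      \<open>a\<close>, which the span avoids.\<close>
    have "- (s /\<^sub>R t) \<in> span B" using s by (intro span_neg span_scale)
    then have "d \<le> dist a (- (s /\<^sub>R t))" using d(2) by (meson ComplD mem_ball not_le subsetD)
    also have "\<dots> = norm (a + s /\<^sub>R t)" by (simp add: dist_norm)
    finally have "\<bar>t\<bar> * d \<le> \<bar>t\<bar> * norm (a + s /\<^sub>R t)" by (simp add: mult_left_mono)
    also have "\<dots> = norm (t *\<^sub>R (a + s /\<^sub>R t))" by simp
    also have "\<dots> = norm (t *\<^sub>R a + s)" using False by (simp add: scaleR_add_right)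
    finally show ?thesis by (simp add: mult.commute)
  qed (use d in simp)
  \<comment> \<open>\<open>k\<close> adds two bounds relative to the norm of the full combination:
    \<open>1 / d\<close> for the coefficient of \<open>a\<close>, and
    \<open>(1 + norm a / d) / c\<close> for the remaining ones.\<close>
  define k where "k = 1 / d + (1 + norm a / d) / c"
  have "k > 0" using c d by (auto simp: k_def intro!: add_pos_nonneg)
  have est: "\<bar>r a\<bar> + (\<Sum>b\<in>B. \<bar>r b\<bar>) \<le> k * norm (r a *\<^sub>R a + (\<Sum>b\<in>B. r b *\<^sub>R b))" for r
  proof -
    let ?s = "\<Sum>b\<in>B. r b *\<^sub>R b"
    let ?N = "norm (r a *\<^sub>R a + ?s)"
    have "?s \<in> span B" by (simp add: span_sum span_scale span_base)
    then have 1: "\<bar>r a\<bar> \<le> ?N / d" using far[of ?s "r a"] d(1) by (simp add: pos_le_divide_eq mult.commute)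
    have "norm ?s \<le> ?N + norm (r a *\<^sub>R a)" by (smt (verit) norm_triangle_ineq4 add_diff_cancel_left')
    also have "\<dots> \<le> ?N + ?N / d * norm a" using mult_right_mono[OF 1, of "norm a"] by simp
    also have "\<dots> = (1 + norm a / d) * ?N" by (simp add: field_simps)
    finally have "c * (\<Sum>b\<in>B. \<bar>r b\<bar>) \<le> (1 + norm a / d) * ?N" using c(2)[of r] by linarith
    then have "(\<Sum>b\<in>B. \<bar>r b\<bar>) \<le> (1 + norm a / d) * ?N / c"
      using c(1) by (simp add: field_simps)
    with 1 show ?thesis by (simp add: k_def algebra_simps)
  qed
  have "1 / k * (\<Sum>b\<in>insert a B. \<bar>r b\<bar>) \<le> norm (\<Sum>b\<in>insert a B. r b *\<^sub>R b)" for r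
    using est[of r] insert.hyps \<open>k > 0\<close> by (simp add: field_simps)
  then show ?case using \<open>k > 0\<close> by (intro exI[of _ "1 / k"]) auto
qed

text \<open>
  The coordinate functionals have to be bounded: \<open>Blinfun\<close>, which occurs in \<^const>\<open>cotangent_chart\<close>,
  is meaningless on unbounded functionals.
\<close>

definition dual_frame :: "'v::real_normed_vector set \<Rightarrow> ('v \<Rightarrow> 'v \<Rightarrow>\<^sub>L real) \<Rightarrow> bool" where
  "dual_frame B \<beta> \<longleftrightarrow> finite B \<and> (\<forall>x. (\<Sum>b\<in>B. \<beta> b x *\<^sub>R b) = x)"

text \<open>For a basis drawn from \<open>S\<close>, the lower bound \<open>c\<close> bounds each
  coordinate functional by \<open>1 / c\<close>.\<close>

lemma dual_frame_exists:
  fixes S :: "'v::real_normed_vector set"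
  assumes "finite S" "span S = UNIV"
  shows "\<exists>B (\<beta> :: 'v \<Rightarrow> 'v \<Rightarrow>\<^sub>L real). dual_frame B \<beta>"
proof -
  obtain B where B: "B \<subseteq> S" "independent B" "S \<subseteq> span B"
    using maximal_independent_subset by blast
  have fin: "finite B" using B(1) assms(1) finite_subset by blast
  have "span S \<subseteq> span B" using B(3) by (simp add: span_minimal)
  then have sp: "span B = UNIV" using assms(2) by auto
  obtain c where c: "c > 0"
    "\<And>r. c * (\<Sum>b\<in>B. \<bar>r b\<bar>) \<le> norm (\<Sum>b\<in>B. r b *\<^sub>R b)"
    using independent_coefficient_bound[OF fin B(2)] by blast
  have rep: "(\<Sum>b\<in>B. representation B x b *\<^sub>R b) = x" for x
    using B(2) fin sp by (intro real_vector.sum_representation_eq) auto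
  have "bounded_linear (\<lambda>x. representation B x b)" for b
  proof (rule bounded_linear_intro[where K = "1 / c"])
    fix x y r
    show "representation B (x + y) b = representation B x b + representation B y b"
      using B(2) sp by (simp add: real_vector.representation_add)
    show "representation B (r *\<^sub>R x) b = r *\<^sub>R representation B x b"
      using B(2) sp by (simp add: real_vector.representation_scale)
    \<comment> \<open>Boundedness is claimed for every \<open>b\<close>, including those outside
      \<open>B\<close>, where \<open>representation\<close> returns 0.\<close>
    have "\<bar>representation B x b\<bar> \<le> (\<Sum>b\<in>B. \<bar>representation B x b\<bar>)"
    proof (cases "b \<in> B")
      case True then show ?thesis using fin by (intro member_le_sum) auto
    next
      case False
      then have "representation B x b = 0" using real_vector.representation_ne_zero by blast
      then show ?thesis by (simp add: sum_nonneg)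
    qed
    also have "\<dots> \<le> norm x / c" using c(2)[of "representation B x"] c(1) by (simp add: rep field_simps)
    finally show "norm (representation B x b) \<le> norm x * (1 / c)" by simp
  qed
  then have "dual_frame B (\<lambda>b. Blinfun (\<lambda>x. representation B x b))"
    using fin rep by (simp add: dual_frame_def bounded_linear_Blinfun_apply)
  then show ?thesis by blast
qed

lemma dual_frame_linear:
  fixes f :: "'v::real_normed_vector \<Rightarrow> 'w::real_normed_vector"
    and \<beta> :: "'v \<Rightarrow> 'v \<Rightarrow>\<^sub>L real"
  assumes "dual_frame B \<beta>" "linear f"
  shows "f x = (\<Sum>b\<in>B. \<beta> b x *\<^sub>R f b)"
proof -
  have "f x = f (\<Sum>b\<in>B. \<beta> b x *\<^sub>R b)" using assms(1) by (simp add: dual_frame_def)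
  also have "\<dots> = (\<Sum>b\<in>B. \<beta> b x *\<^sub>R f b)" using assms(2) by (simp add: linear_sum linear_scale)
  finally show ?thesis .
qed

text \<open>Automatic continuity: the frame expansion is a finite sum of bounded functionals times
  the fixed vectors \<open>f b\<close>.\<close>

lemma dual_frame_bounded_linear:
  fixes f :: "'v::real_normed_vector \<Rightarrow> 'w::real_normed_vector"
    and \<beta> :: "'v \<Rightarrow> 'v \<Rightarrow>\<^sub>L real"
  assumes "dual_frame B \<beta>" "linear f"
  shows "bounded_linear f"
proof -
  have "f = (\<lambda>x. \<Sum>b\<in>B. \<beta> b x *\<^sub>R f b)" using dual_frame_linear[OF assms] by blast
  moreover have "bounded_linear (\<lambda>x. \<Sum>b\<in>B. \<beta> b x *\<^sub>R f b)"
    by (intro bounded_linear_sum bounded_linear_scaleR_const blinfun.bounded_linear_right)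
  ultimately show ?thesis by simp
qed

text \<open>The frame expansion of a functional, read the other way round: the \<beta> functionals
  span the dual space, with the values on \<open>B\<close> as coefficients.\<close>

lemma dual_frame_blinfun:
  fixes a :: "'v::real_normed_vector \<Rightarrow>\<^sub>L real"
  assumes "dual_frame B \<beta>"
  shows "a = (\<Sum>b\<in>B. a b *\<^sub>R \<beta> b)"
proof (rule blinfun_eqI)
  fix x
  have "linear (blinfun_apply a)" by (simp add: blinfun.bounded_linear_right bounded_linear.linear)
  then show "a x = (\<Sum>b\<in>B. a b *\<^sub>R \<beta> b) x"
    using dual_frame_linear[OF assms, of "blinfun_apply a" x]
    by (simp add: blinfun.sum_left blinfun.scaleR_left mult.commute)
qed

lemma dual_frame_phase_space_span:
  fixes \<beta> :: "'v::real_normed_vector \<Rightarrow> 'v \<Rightarrow>\<^sub>L real"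
  assumes "dual_frame B \<beta>"
  shows "span ((\<lambda>b. (b, 0)) ` B \<union> (\<lambda>b. (0, \<beta> b)) ` B) = UNIV" (is "span ?S = _")
proof -
  have "(x, a) \<in> span ?S" for x a
  proof -
    have "(x, a) = (\<Sum>b\<in>B. \<beta> b x *\<^sub>R (b, 0)) + (\<Sum>b\<in>B. a b *\<^sub>R (0, \<beta> b))"
      using assms
      by (intro prod_eqI) (simp_all add: fst_sum snd_sum dual_frame_def flip: dual_frame_blinfun[OF assms])
    also have "\<dots> \<in> span ?S"
      by (intro span_add span_sum span_scale span_base) auto
    finally show ?thesis .
  qed
  then show ?thesis by auto
qed

lemma linear_inj_imp_surj_finite_span:
  fixes f :: "'v::real_vector \<Rightarrow> 'v" and S :: "'v set"
  assumes "finite S" "span S = UNIV" "linear f" "inj f"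
  shows "surj f"
proof -
  obtain B where B: "B \<subseteq> S" "independent B" "S \<subseteq> span B"
    using maximal_independent_subset by blast
  have fin: "finite B" using B(1) assms(1) finite_subset by blast
  have "span S \<subseteq> span B" using B(3) by (simp add: span_minimal)
  then have sp: "span B = UNIV" using assms(2) by auto
  \<comment> \<open>The type carries no dimension class, so the finite-dimensional theory is
    instantiated locally with a basis drawn from \<open>S\<close>.\<close>
  interpret fd: finite_dimensional_vector_space "scaleR :: real \<Rightarrow> 'v \<Rightarrow> 'v" B
    using B(2) fin sp by unfold_locales (auto simp: dependent_raw_def span_raw_def)
  show ?thesis using assms(3,4) fd.linear_inj_imp_surj[of f]
    by (simp add: linear_def)
qed

section \<open>The symplectic form of phase space\<close>

definition phase_form ::
  "'e::real_normed_vector \<times> ('e \<Rightarrow>\<^sub>L real) \<Rightarrow> 'e \<times> ('e \<Rightarrow>\<^sub>L real) \<Rightarrow> real" where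
  "phase_form v w = blinfun_apply (snd w) (fst v) - blinfun_apply (snd v) (fst w)"

lemma phase_form_diff_left: "phase_form (v - v') w = phase_form v w - phase_form v' w"
  by (simp add: phase_form_def blinfun.diff_left blinfun.diff_right)

text \<open>Pairing with \<open>(x, 0)\<close> detects the fibre component, pairing with
  \<open>(0, \<beta> b)\<close> the frame coordinates of the base component.\<close>

lemma phase_form_nondegenerate:
  fixes \<beta> :: "'e::real_normed_vector \<Rightarrow> 'e \<Rightarrow>\<^sub>L real"
    and v :: "'e \<times> ('e \<Rightarrow>\<^sub>L real)"
  assumes B: "dual_frame B \<beta>" and v: "\<And>w. phase_form v w = 0"
  shows "v = 0"
proof -
  have "blinfun_apply (snd v) x = 0" for x using v[of "(x, 0)"] by (simp add: phase_form_def)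
  then have "snd v = 0" by (simp add: blinfun_eqI)
  moreover have "\<beta> b (fst v) = 0" for b using v[of "(0, \<beta> b)"] by (simp add: phase_form_def)
  then have "(\<Sum>b\<in>B. \<beta> b (fst v) *\<^sub>R b) = 0" by simp
  then have "fst v = 0" using B by (simp add: dual_frame_def)
  ultimately show ?thesis by (simp add: prod_eq_iff)
qed

text \<open>Existence of Hamiltonian vectors: the solution is written down by Hamilton's
  equations.\<close>

lemma phase_form_represents:
  fixes \<beta> :: "'e::real_normed_vector \<Rightarrow> 'e \<Rightarrow>\<^sub>L real"
    and \<phi> :: "'e \<times> ('e \<Rightarrow>\<^sub>L real) \<Rightarrow> real"
  assumes B: "dual_frame B \<beta>" and \<phi>: "linear \<phi>"
  shows "\<exists>v. \<forall>w. phase_form v w = \<phi> w"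
proof -
  have add: "\<phi> (x, a) = \<phi> (x, 0) + \<phi> (0, a)" for x a
    using linear_add[OF \<phi>, of "(x, 0)" "(0, a)"] by simp
  have "linear (\<lambda>x. (x, 0 :: 'e \<Rightarrow>\<^sub>L real))" "linear (\<lambda>a. (0 :: 'e, a))"
    by (auto intro!: linearI)
  from this[THEN linear_compose[OF _ \<phi>]]
  have lin: "linear (\<lambda>x. \<phi> (x, 0))" "linear (\<lambda>a. \<phi> (0, a))"
    by (simp_all add: o_def)
  have bl: "bounded_linear (\<lambda>x. - \<phi> (x, 0))"
    using dual_frame_bounded_linear[OF B lin(1)] by (rule bounded_linear_minus)
  \<comment> \<open>The base component is the derivative of \<phi> in the momentum directions, the
    fibre component is minus its derivative in the position directions.\<close>
  let ?v = "(\<Sum>b\<in>B. \<phi> (0, \<beta> b) *\<^sub>R b, Blinfun (\<lambda>x. - \<phi> (x, 0)))"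
  \<comment> \<open>A functional on the dual space is evaluation at a vector: finite-dimensional
    reflexivity, with the vector given by the frame.\<close>
  have dual: "\<phi> (0, a) = a (\<Sum>b\<in>B. \<phi> (0, \<beta> b) *\<^sub>R b)" for a
  proof -
    have "\<phi> (0, a) = \<phi> (0, \<Sum>b\<in>B. a b *\<^sub>R \<beta> b)" by (simp flip: dual_frame_blinfun[OF B])
    also have "\<dots> = (\<Sum>b\<in>B. a b * \<phi> (0, \<beta> b))"
      by (simp add: linear_sum[OF lin(2)] linear_scale[OF lin(2)])
    finally show ?thesis by (simp add: blinfun.sum_right blinfun.scaleR_right mult.commute)
  qed
  have "phase_form ?v (x, a) = \<phi> (x, a)" for x a
    using add[of x a] dual[of a] by (simp add: phase_form_def bounded_linear_Blinfun_apply[OF bl])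
  then have "\<forall>w. phase_form ?v w = \<phi> w" by (simp only: split_paired_All) blast
  then show ?thesis by (rule exI)
qed

lemma phase_form_isometry_surj:
  fixes \<beta> :: "'e::real_normed_vector \<Rightarrow> 'e \<Rightarrow>\<^sub>L real"
    and L :: "'e \<times> ('e \<Rightarrow>\<^sub>L real) \<Rightarrow> 'e \<times> ('e \<Rightarrow>\<^sub>L real)"
  assumes B: "dual_frame B \<beta>" and L: "linear L"
    and iso: "\<And>v w. phase_form (L v) (L w) = phase_form v w"
  shows "surj L"
proof (rule linear_inj_imp_surj_finite_span[OF _ dual_frame_phase_space_span[OF B] L])
  show "finite ((\<lambda>b. (b, 0)) ` B \<union> (\<lambda>b. (0, \<beta> b)) ` B)" using B by (simp add: dual_frame_def)
  have "v = 0" if "L v = 0" for v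
  proof (rule phase_form_nondegenerate[OF B])
    fix w
    \<comment> \<open>A kernel vector pairs with everything as \<open>L v = 0\<close> does, so it
      lies in the radical of the form.\<close>
    have "phase_form v w = phase_form 0 (L w)" using iso[of v w] that by simp
    then show "phase_form v w = 0" by (simp add: phase_form_def)
  qed
  then show "inj L" using L by (simp add: linear_injective_0)
qed

section \<open>Differentiable maps in charts\<close>

abbreviation local_deriv ::
  "('a, 'e::real_normed_vector) chart \<Rightarrow> ('b, 'f::real_normed_vector) chart \<Rightarrow> ('a \<Rightarrow> 'b) \<Rightarrow> 'a \<Rightarrow> 'e \<Rightarrow> 'f"
  where "local_deriv c d f p \<equiv> frechet_derivative (local_rep c d f) (at (snd c p))"

text \<open>
  Only first derivatives enter the theorem. Working with maps that are merely differentiable in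
  charts avoids proving that the transition maps of the cotangent bundle are smooth to all orders.
\<close>

definition diff_map ::
  "('a, 'e::real_normed_vector) atlas \<Rightarrow> ('b, 'f::real_normed_vector) atlas \<Rightarrow> ('a \<Rightarrow> 'b) \<Rightarrow> bool" where
  "diff_map A B f \<longleftrightarrow> f ` points A \<subseteq> points B \<and>
     (\<forall>c\<in>A. \<forall>d\<in>B. open (snd c ` (fst c \<inter> f -` fst d)) \<and>
        (\<forall>x\<in>snd c ` (fst c \<inter> f -` fst d). local_rep c d f differentiable at x))"

text \<open>Transition maps appear as local representatives of \<open>id\<close>, so that every
  change-of-chart law is the chain rule with \<open>id\<close> as one factor.\<close>

definition diff_atlas :: "('a, 'e::real_normed_vector) atlas \<Rightarrow> bool" where
  "diff_atlas A \<longleftrightarrow> (\<forall>c\<in>A. inj_on (snd c) (fst c)) \<and> diff_map A A id"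

lemma smooth_on_differentiable: "smooth_on S f \<Longrightarrow> x \<in> S \<Longrightarrow> f differentiable at x"
  unfolding smooth_on_def by (metis Ck_on.simps(2))

text \<open>Extracts a second derivative: the fibre coordinates of a cotangent transition already
  contain a first derivative of a base transition.\<close>

lemma smooth_on_frechet_derivative_differentiable:
  assumes "smooth_on S f" "x \<in> S"
  shows "(\<lambda>x. frechet_derivative f (at x) u) differentiable at x"
proof -
  have "Ck_on (Suc (Suc 0)) S f" using assms(1) unfolding smooth_on_def by blast
  then show ?thesis using assms(2) by simp
qed

lemma smooth_atlas_imp_diff_atlas: "smooth_atlas A \<Longrightarrow> diff_atlas A"
  unfolding smooth_atlas_def diff_atlas_def diff_map_def
  by (auto intro: smooth_on_differentiable)

lemma diff_atlas_inj: "diff_atlas A \<Longrightarrow> c \<in> A \<Longrightarrow> inj_on (snd c) (fst c)"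
  by (simp add: diff_atlas_def)

lemma diff_atlas_open:
  assumes "diff_atlas A" "c \<in> A"
  shows "open (snd c ` fst c)"
proof -
  have "open (snd c ` (fst c \<inter> id -` fst c))"
    using assms unfolding diff_atlas_def diff_map_def by blast
  then show ?thesis by simp
qed

lemma diff_atlas_id: "diff_atlas A \<Longrightarrow> diff_map A A id"
  by (simp add: diff_atlas_def)

lemma diff_map_points: "diff_map A B f \<Longrightarrow> p \<in> points A \<Longrightarrow> f p \<in> points B"
  by (auto simp: diff_map_def)

lemma chart_inv_chart: "inj_on (snd c) (fst c) \<Longrightarrow> p \<in> fst c \<Longrightarrow> chart_inv c (snd c p) = p"
  by (simp add: chart_inv_def)

lemma chart_at:
  assumes "p \<in> points A"
  shows "chart_at A p \<in> A" "p \<in> fst (chart_at A p)"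
proof -
  have "\<exists>c. c \<in> A \<and> p \<in> fst c" using assms by (auto simp: points_def)
  then show "chart_at A p \<in> A" "p \<in> fst (chart_at A p)"
    unfolding chart_at_def by (metis (mono_tags, lifting) someI_ex)+
qed

lemma pointsI: "c \<in> A \<Longrightarrow> p \<in> fst c \<Longrightarrow> p \<in> points A"
  by (auto simp: points_def)

lemma local_rep_has_derivative:
  assumes "diff_map A B f" "c \<in> A" "d \<in> B" "p \<in> fst c" "f p \<in> fst d"
  shows "(local_rep c d f has_derivative local_deriv c d f p) (at (snd c p))"
  using assms unfolding diff_map_def by (auto simp flip: frechet_derivative_works)

text \<open>The local representatives compose exactly where \<open>f\<close> lands in the middle
  chart \<open>d\<close>, an open set in coordinates. For \<open>g\<close> only a derivative at one
  point is assumed, which lets the lemma serve the Hamiltonian as well.\<close>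

lemma local_rep_comp_has_derivative:
  assumes A: "diff_atlas A" and B: "diff_atlas B" and f: "diff_map A B f"
    and cd: "c \<in> A" "d \<in> B" "p \<in> fst c" "f p \<in> fst d"
    and g: "(local_rep d e g has_derivative g') (at (snd d (f p)))"
  shows "(local_rep c e (g \<circ> f) has_derivative g' \<circ> local_deriv c d f p) (at (snd c p))"
proof (rule has_derivative_transform_within_open)
  have "local_rep c d f (snd c p) = snd d (f p)"
    using cd diff_atlas_inj[OF A] by (simp add: local_rep_def chart_inv_chart)
  then show "(local_rep d e g \<circ> local_rep c d f has_derivative g' \<circ> local_deriv c d f p)
      (at (snd c p))"
    using diff_chain_at[OF local_rep_has_derivative[OF f cd]] g by simp
  show "open (snd c ` (fst c \<inter> f -` fst d))" using f cd by (simp add: diff_map_def)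
  show "snd c p \<in> snd c ` (fst c \<inter> f -` fst d)" using cd by auto
  fix x assume "x \<in> snd c ` (fst c \<inter> f -` fst d)"
  then show "(local_rep d e g \<circ> local_rep c d f) x = local_rep c e (g \<circ> f) x"
    using cd diff_atlas_inj[OF A] diff_atlas_inj[OF B] by (auto simp: local_rep_def chart_inv_chart)
qed

lemma local_deriv_comp:
  assumes A: "diff_atlas A" and B: "diff_atlas B" and f: "diff_map A B f" and g: "diff_map B C g"
    and cd: "c \<in> A" "d \<in> B" "e \<in> C" "p \<in> fst c" "f p \<in> fst d" "g (f p) \<in> fst e"
  shows "local_deriv c e (g \<circ> f) p = local_deriv d e g (f p) \<circ> local_deriv c d f p"
  using local_rep_comp_has_derivative[OF A B f cd(1,2,4,5) local_rep_has_derivative[OF g cd(2,3,5,6)]]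
  by (rule frechet_derivative_at[symmetric])

lemma local_deriv_change_domain:
  assumes A: "diff_atlas A" and f: "diff_map A B f"
    and "c \<in> A" "c' \<in> A" "d \<in> B" "p \<in> fst c" "p \<in> fst c'" "f p \<in> fst d"
  shows "local_deriv c d f p u = local_deriv c' d f p (local_deriv c c' id p u)"
  using local_deriv_comp[OF A A diff_atlas_id[OF A] f, of c c' d p] assms by simp

lemma local_deriv_change_codomain:
  assumes A: "diff_atlas A" and B: "diff_atlas B" and f: "diff_map A B f"
    and "c \<in> A" "d \<in> B" "d' \<in> B" "p \<in> fst c" "f p \<in> fst d" "f p \<in> fst d'"
  shows "local_deriv c d' f p u = local_deriv d d' id (f p) (local_deriv c d f p u)"
  using local_deriv_comp[OF A B f diff_atlas_id[OF B], of c d d' p] assms by simp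

lemma local_deriv_id:
  assumes A: "diff_atlas A" and c: "c \<in> A" "p \<in> fst c"
  shows "local_deriv c c id p = (\<lambda>u. u)"
proof -
  have "(local_rep c c id has_derivative (\<lambda>u. u)) (at (snd c p))"
  proof (rule has_derivative_transform_within_open[OF has_derivative_ident diff_atlas_open[OF A c(1)]])
    fix x assume "x \<in> snd c ` fst c"
    then show "x = local_rep c c id x"
      using diff_atlas_inj[OF A c(1)] by (auto simp: local_rep_def chart_inv_chart)
  qed (use c in auto)
  then show ?thesis by (rule frechet_derivative_at[symmetric])
qed

lemma local_deriv_linear:
  assumes "diff_map A B f" "c \<in> A" "d \<in> B" "p \<in> fst c" "f p \<in> fst d"
  shows "linear (local_deriv c d f p)"
  using local_rep_has_derivative[OF assms] by (rule has_derivative_linear)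

text \<open>The compatibility demanded of the family is the cocycle law of the transition
  derivatives.\<close>

lemma tangent_vector_in:
  assumes A: "diff_atlas A" and c: "c \<in> A" "p \<in> fst c"
  shows "tangent_vector A p c u \<in> tangent_space A p"
  unfolding tangent_space_def mem_Collect_eq
proof (intro conjI allI ballI impI)
  fix d assume "\<not> (d \<in> A \<and> p \<in> fst d)"
  then show "tangent_vector A p c u d = 0" by (auto simp: tangent_vector_def)
next
  fix d e assume de: "d \<in> A" "e \<in> A" "p \<in> fst d \<inter> fst e"
  then show "tangent_vector A p c u e = local_deriv d e id p (tangent_vector A p c u d)"
    using local_deriv_change_codomain[OF A A diff_atlas_id[OF A] c(1) de(1,2) c(2), of u]
    by (simp add: tangent_vector_def)
qed

lemma tangent_vector_apply:
  assumes A: "diff_atlas A" and c: "c \<in> A" "p \<in> fst c"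
  shows "tangent_vector A p c u c = u"
  using local_deriv_id[OF A c] c by (simp add: tangent_vector_def)

lemma tangent_space_transform:
  assumes "v \<in> tangent_space A p" "c \<in> A" "d \<in> A" "p \<in> fst c" "p \<in> fst d"
  shows "v d = local_deriv c d id p (v c)"
  using assms unfolding tangent_space_def by blast

text \<open>With the two preceding facts, evaluation at \<open>c\<close> identifies the tangent
  space with the model space. Equality holds at all indices since both families vanish away from
  charts around \<open>p\<close>.\<close>

lemma tangent_space_eq:
  assumes c: "c \<in> A" "p \<in> fst c" and v: "v \<in> tangent_space A p"
  shows "v = tangent_vector A p c (v c)"
proof
  fix d
  show "v d = tangent_vector A p c (v c) d"
  proof (cases "d \<in> A \<and> p \<in> fst d")
    case True
    then have "v d = local_deriv c d id p (v c)" using tangent_space_transform[OF v c(1) _ c(2)] by simp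
    with True show ?thesis by (simp add: tangent_vector_def)
  next
    case False
    then have "v d = 0" using v unfolding tangent_space_def by blast
    with False show ?thesis by (auto simp: tangent_vector_def)
  qed
qed

lemma tangent_vector_add:
  assumes A: "diff_atlas A" and c: "c \<in> A" "p \<in> fst c"
  shows "tangent_vector A p c (u + u') = (\<lambda>d. tangent_vector A p c u d + tangent_vector A p c u' d)"
  using local_deriv_linear[OF diff_atlas_id[OF A] c(1)] c
  by (auto simp: tangent_vector_def linear_add)

lemma tangent_vector_scale:
  assumes A: "diff_atlas A" and c: "c \<in> A" "p \<in> fst c"
  shows "tangent_vector A p c (r *\<^sub>R u) = (\<lambda>d. r *\<^sub>R tangent_vector A p c u d)"
  using local_deriv_linear[OF diff_atlas_id[OF A] c(1)] c
  by (auto simp: tangent_vector_def linear_scale)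

text \<open>Frees the tangent map from the chart picked by \<open>chart_at\<close>: the transition
  derivative relating the coordinates of \<open>v\<close> is absorbed by the derivative of
  \<open>f\<close>.\<close>

lemma tangent_map_apply:
  assumes A: "diff_atlas A" and f: "diff_map A B f" and v: "v \<in> tangent_space A p"
    and c: "c \<in> A" "d \<in> B" "p \<in> fst c" "f p \<in> fst d"
  shows "snd (tangent_map A B f (p, v)) d = local_deriv c d f p (v c)"
proof -
  have p: "chart_at A p \<in> A" "p \<in> fst (chart_at A p)" using chart_at pointsI c by metis+
  then have "v c = local_deriv (chart_at A p) c id p (v (chart_at A p))"
    using tangent_space_transform[OF v] c by blast
  then show ?thesis
    using local_deriv_change_domain[OF A f p(1) c(1,2) p(2) c(3,4), of "v (chart_at A p)"] c
    by (simp add: tangent_map_def)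
qed

lemma tangent_map_in:
  assumes A: "diff_atlas A" and B: "diff_atlas B" and f: "diff_map A B f" and p: "p \<in> points A"
  shows "snd (tangent_map A B f (p, v)) \<in> tangent_space B (f p)"
  unfolding tangent_space_def mem_Collect_eq
proof (intro conjI allI ballI impI)
  fix d assume "\<not> (d \<in> B \<and> f p \<in> fst d)"
  then show "snd (tangent_map A B f (p, v)) d = 0" by (auto simp: tangent_map_def)
next
  fix d e assume de: "d \<in> B" "e \<in> B" "f p \<in> fst d \<inter> fst e"
  then show "snd (tangent_map A B f (p, v)) e
      = local_deriv d e id (f p) (snd (tangent_map A B f (p, v)) d)"
    using local_deriv_change_codomain[OF A B f chart_at(1)[OF p] de(1,2) chart_at(2)[OF p]]
    by (simp add: tangent_map_def)
qed

text \<open>Both sides read \<open>X\<close> only in the chart picked at its base point, which is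
  why the assumption concerns \<open>fst X\<close> alone.\<close>

lemma tangent_map_comp:
  assumes A: "diff_atlas A" and B: "diff_atlas B" and f: "diff_map A B f" and g: "diff_map B C g"
    and p: "fst X \<in> points A"
  shows "tangent_map A C (g \<circ> f) X = tangent_map B C g (tangent_map A B f X)"
  using local_deriv_comp[OF A B f g chart_at(1)[OF p] chart_at(1)[OF diff_map_points[OF f p]]]
    chart_at[OF p] chart_at[OF diff_map_points[OF f p]]
  by (cases X) (auto simp: tangent_map_def)

text \<open>
  Unlike \<open>openin_manifold_topology\<close>, this applies to the cotangent bundle without knowing
  that it is a smooth atlas.
\<close>

lemma openin_manifold_topology_inj:
  assumes inj: "\<forall>c\<in>A. inj_on (snd c) (fst c)"
  shows "openin (manifold_topology A) W \<longleftrightarrow>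
    W \<subseteq> points A \<and> (\<forall>c\<in>A. open (snd c ` (fst c \<inter> W)))"
proof -
  have "istopology (\<lambda>W. W \<subseteq> points A \<and> (\<forall>c\<in>A. open (snd c ` (fst c \<inter> W))))"
    unfolding istopology_def
  proof (intro conjI allI impI ballI)
    fix S T c
    assume *: "S \<subseteq> points A \<and> (\<forall>c\<in>A. open (snd c ` (fst c \<inter> S)))"
      "T \<subseteq> points A \<and> (\<forall>c\<in>A. open (snd c ` (fst c \<inter> T)))" and c: "c \<in> A"
    have "snd c ` (fst c \<inter> (S \<inter> T)) = snd c ` (fst c \<inter> S) \<inter> snd c ` (fst c \<inter> T)"
      using inj_onD[OF bspec[OF inj c]] by blast
    then show "open (snd c ` (fst c \<inter> (S \<inter> T)))" using * c by (simp add: open_Int)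
  next
    fix K c
    assume K: "\<forall>S\<in>K. S \<subseteq> points A \<and> (\<forall>c\<in>A. open (snd c ` (fst c \<inter> S)))" and c: "c \<in> A"
    have "snd c ` (fst c \<inter> \<Union>K) = (\<Union>S\<in>K. snd c ` (fst c \<inter> S))" by auto
    then show "open (snd c ` (fst c \<inter> \<Union>K))" using K c by auto
  qed auto
  then show ?thesis by (simp add: manifold_topology_def)
qed

text \<open>The differentiability part is immediate. Openness of the coordinate domains has to be
  recovered from topological continuity, using that chart domains are open in the manifold
  topology.\<close>

lemma smooth_map_imp_diff_map:
  assumes A: "diff_atlas A" and B: "diff_atlas B" and f: "smooth_map A B f"
  shows "diff_map A B f"
  unfolding diff_map_def
proof (intro conjI ballI)
  have inj: "\<forall>c\<in>A. inj_on (snd c) (fst c)" "\<forall>c\<in>B. inj_on (snd c) (fst c)"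
    using A B by (auto simp: diff_atlas_def)
  note oA = openin_manifold_topology_inj[OF inj(1)]
    and oB = openin_manifold_topology_inj[OF inj(2)]
  have fc: "continuous_map (manifold_topology A) (manifold_topology B) f"
    using f by (simp add: smooth_map_def)
  have "openin (manifold_topology A) (points A)"
    unfolding oA
  proof (intro conjI ballI)
    fix c assume c: "c \<in> A"
    then have "fst c \<inter> points A = fst c" by (auto simp: points_def)
    then show "open (snd c ` (fst c \<inter> points A))" using diff_atlas_open[OF A c] by simp
  qed simp
  then have tA: "topspace (manifold_topology A) = points A"
    using oA openin_subset openin_topspace by (metis subset_antisym)
  have tB: "topspace (manifold_topology B) \<subseteq> points B"
    using oB openin_topspace by metis
  show "f ` points A \<subseteq> points B"
    using fc tA tB by (auto simp: continuous_map_def)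
  fix c d assume cd: "c \<in> A" "d \<in> B"
  have "openin (manifold_topology B) (fst d)"
    unfolding oB
  proof (intro conjI ballI)
    show "fst d \<subseteq> points B" using cd by (auto simp: points_def)
    fix e assume e: "e \<in> B"
    have "open (snd e ` (fst e \<inter> id -` fst d))"
      using diff_atlas_id[OF B] e cd unfolding diff_map_def by blast
    then show "open (snd e ` (fst e \<inter> fst d))" by simp
  qed
  then have "openin (manifold_topology A) {p \<in> points A. f p \<in> fst d}"
    using fc tA by (auto simp: continuous_map_def)
  moreover have "fst c \<inter> {p \<in> points A. f p \<in> fst d} = fst c \<inter> f -` fst d"
    using cd by (auto simp: points_def)
  ultimately show "open (snd c ` (fst c \<inter> f -` fst d))" using cd oA by metis
  fix x assume "x \<in> snd c ` (fst c \<inter> f -` fst d)"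
  then show "local_rep c d f differentiable at x"
    using f cd unfolding smooth_map_def by (blast intro: smooth_on_differentiable)
qed

section \<open>The cotangent bundle\<close>

text \<open>Inverse of the fibre coordinate of \<open>cotangent_chart Q c\<close> at
  \<open>q\<close>; the default 0 is the normal form that \<open>cotangent_space\<close>
  prescribes.\<close>

definition lift_covector ::
  "('a, 'e::real_normed_vector) atlas \<Rightarrow> ('a, 'e) chart \<Rightarrow> 'a \<Rightarrow> ('e \<Rightarrow>\<^sub>L real) \<Rightarrow> ('a, 'e) tangent \<Rightarrow> real"
  where "lift_covector Q c q a = (\<lambda>v. if v \<in> tangent_space Q q then a (v c) else 0)"

lemma smooth_manifold_dual_frame:
  fixes Q :: "('a, 'e::real_normed_vector) atlas"
  assumes "smooth_manifold Q"
  shows "\<exists>B (\<beta> :: 'e \<Rightarrow> 'e \<Rightarrow>\<^sub>L real). dual_frame B \<beta>"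
proof -
  obtain S :: "'e set" where "finite S" "span S = UNIV"
    using assms unfolding smooth_manifold_def by blast
  then show ?thesis by (rule dual_frame_exists)
qed

lemma lift_covector_in:
  assumes Q: "diff_atlas Q" and c: "c \<in> Q" "q \<in> fst c"
  shows "lift_covector Q c q a \<in> cotangent_space Q q"
proof -
  \<comment> \<open>The case distinction in \<open>lift_covector\<close> is linear only because the
    tangent space is closed under the pointwise operations; the chart \<open>c\<close> transfers
    this from the model space.\<close>
  have "(\<lambda>c. v c + w c) \<in> tangent_space Q q" "(\<lambda>c. r *\<^sub>R v c) \<in> tangent_space Q q"
    if v: "v \<in> tangent_space Q q" "w \<in> tangent_space Q q" for v w r
  proof -
    have *: "v = tangent_vector Q q c (v c)" "w = tangent_vector Q q c (w c)"
      using tangent_space_eq[OF c] v by auto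
    have "(\<lambda>d. v d + w d) = tangent_vector Q q c (v c + w c)"
      using tangent_vector_add[OF Q c, of "v c" "w c"] * by simp
    then show "(\<lambda>c. v c + w c) \<in> tangent_space Q q"
      using tangent_vector_in[OF Q c] by simp
    have "(\<lambda>d. r *\<^sub>R v d) = tangent_vector Q q c (r *\<^sub>R v c)"
      using tangent_vector_scale[OF Q c, of r "v c"] * by simp
    then show "(\<lambda>c. r *\<^sub>R v c) \<in> tangent_space Q q"
      using tangent_vector_in[OF Q c] by simp
  qed
  then show ?thesis
    by (auto simp: cotangent_space_def lift_covector_def blinfun.add_right blinfun.scaleR_right)
qed

lemma covector_chart_linear:
  assumes Q: "diff_atlas Q" and c: "c \<in> Q" "q \<in> fst c" and \<alpha>: "\<alpha> \<in> cotangent_space Q q"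
  shows "linear (\<lambda>u. \<alpha> (tangent_vector Q q c u))"
  using \<alpha> tangent_vector_in[OF Q c]
  by (intro linearI) (auto simp: cotangent_space_def tangent_vector_add[OF Q c] tangent_vector_scale[OF Q c])

lemma covector_chart_apply:
  fixes Q :: "('a, 'e::real_normed_vector) atlas" and \<beta> :: "'e \<Rightarrow> 'e \<Rightarrow>\<^sub>L real"
  assumes B: "dual_frame B \<beta>" and Q: "diff_atlas Q" and c: "c \<in> Q" "q \<in> fst c"
    and \<alpha>: "\<alpha> \<in> cotangent_space Q q"
  shows "blinfun_apply (snd (snd (cotangent_chart Q c) (q, \<alpha>))) u = \<alpha> (tangent_vector Q q c u)"
  using dual_frame_bounded_linear[OF B covector_chart_linear[OF Q c \<alpha>]]
  by (simp add: cotangent_chart_def bounded_linear_Blinfun_apply)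

lemma covector_eq_lift:
  fixes Q :: "('a, 'e::real_normed_vector) atlas" and \<beta> :: "'e \<Rightarrow> 'e \<Rightarrow>\<^sub>L real"
  assumes B: "dual_frame B \<beta>" and Q: "diff_atlas Q" and c: "c \<in> Q" "q \<in> fst c"
    and \<alpha>: "\<alpha> \<in> cotangent_space Q q"
  shows "\<alpha> = lift_covector Q c q (snd (snd (cotangent_chart Q c) (q, \<alpha>)))"
proof
  fix v
  show "\<alpha> v = lift_covector Q c q (snd (snd (cotangent_chart Q c) (q, \<alpha>))) v"
    using \<alpha> tangent_space_eq[OF c, of v] covector_chart_apply[OF assms]
    by (auto simp: lift_covector_def cotangent_space_def)
qed

text \<open>Covectors transform by precomposition with the reversed transition derivative, from
  \<open>d\<close> to \<open>c\<close>. Expanding in the fixed \<beta> functionals leaves only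
  scalar coefficients to differentiate later.\<close>

lemma cotangent_chart_lift:
  fixes Q :: "('a, 'e::real_normed_vector) atlas" and \<beta> :: "'e \<Rightarrow> 'e \<Rightarrow>\<^sub>L real"
  assumes B: "dual_frame B \<beta>" and Q: "diff_atlas Q"
    and c: "c \<in> Q" "q \<in> fst c" and d: "d \<in> Q" "q \<in> fst d"
  shows "snd (cotangent_chart Q d) (q, lift_covector Q c q a)
    = (snd d q, \<Sum>b\<in>B. a (local_deriv d c id q b) *\<^sub>R \<beta> b)"
proof -
  let ?L = "snd (snd (cotangent_chart Q d) (q, lift_covector Q c q a))"
  have "?L u = a (local_deriv d c id q u)" for u
    using covector_chart_apply[OF B Q d lift_covector_in[OF Q c]] tangent_vector_in[OF Q d] c
    by (simp add: lift_covector_def tangent_vector_def)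
  then have L: "blinfun_apply ?L = (\<lambda>u. a (local_deriv d c id q u))" by blast
  have "?L = (\<Sum>b\<in>B. ?L b *\<^sub>R \<beta> b)" by (rule dual_frame_blinfun[OF B])
  then have "?L = (\<Sum>b\<in>B. a (local_deriv d c id q b) *\<^sub>R \<beta> b)" unfolding L .
  moreover have "fst (snd (cotangent_chart Q d) (q, lift_covector Q c q a)) = snd d q"
    by (simp add: cotangent_chart_def)
  ultimately show ?thesis by (metis prod.collapse)
qed

lemma cotangent_chart_lift_same:
  fixes Q :: "('a, 'e::real_normed_vector) atlas" and \<beta> :: "'e \<Rightarrow> 'e \<Rightarrow>\<^sub>L real"
  assumes B: "dual_frame B \<beta>" and Q: "diff_atlas Q" and c: "c \<in> Q" "q \<in> fst c"
  shows "snd (cotangent_chart Q c) (q, lift_covector Q c q a) = (snd c q, a)"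
  by (simp add: cotangent_chart_lift[OF B Q c c] local_deriv_id[OF Q c] flip: dual_frame_blinfun[OF B])

lemma fst_cotangent_chart: "fst (cotangent_chart Q c) = Sigma (fst c) (cotangent_space Q)"
  by (simp add: cotangent_chart_def)

lemma fst_snd_cotangent_chart: "fst (snd (cotangent_chart Q c) z) = snd c (fst z)"
  by (simp add: cotangent_chart_def split: prod.split)

lemma cotangent_chart_inj:
  fixes Q :: "('a, 'e::real_normed_vector) atlas" and \<beta> :: "'e \<Rightarrow> 'e \<Rightarrow>\<^sub>L real"
  assumes B: "dual_frame B \<beta>" and Q: "diff_atlas Q" and c: "c \<in> Q"
  shows "inj_on (snd (cotangent_chart Q c)) (fst (cotangent_chart Q c))"
proof (rule inj_onI)
  fix z z'
  assume z: "z \<in> fst (cotangent_chart Q c)" and z': "z' \<in> fst (cotangent_chart Q c)"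
    and eq: "snd (cotangent_chart Q c) z = snd (cotangent_chart Q c) z'"
  have "snd c (fst z) = snd c (fst z')" using eq by (metis fst_snd_cotangent_chart)
  then have q: "fst z = fst z'"
    using z z' diff_atlas_inj[OF Q c] by (auto simp: fst_cotangent_chart inj_on_eq_iff)
  have "snd z = lift_covector Q c (fst z) (snd (snd (cotangent_chart Q c) z))"
    "snd z' = lift_covector Q c (fst z') (snd (snd (cotangent_chart Q c) z'))"
    using covector_eq_lift[OF B Q c] z z' by (auto simp: fst_cotangent_chart)
  then show "z = z'" using eq q by (simp add: prod_eq_iff)
qed

text \<open>Lifts realise every functional, so the image is a product with the full dual space and
  its openness is decided on the base.\<close>

lemma cotangent_chart_image:
  fixes Q :: "('a, 'e::real_normed_vector) atlas" and \<beta> :: "'e \<Rightarrow> 'e \<Rightarrow>\<^sub>L real"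
  assumes B: "dual_frame B \<beta>" and Q: "diff_atlas Q" and c: "c \<in> Q" and U: "U \<subseteq> fst c"
  shows "snd (cotangent_chart Q c) ` Sigma U (cotangent_space Q) = (snd c ` U) \<times> UNIV"
proof (intro equalityI subsetI)
  fix x assume "x \<in> snd (cotangent_chart Q c) ` Sigma U (cotangent_space Q)"
  then show "x \<in> (snd c ` U) \<times> UNIV" by (auto simp: cotangent_chart_def)
next
  fix x assume "x \<in> (snd c ` U) \<times> (UNIV :: ('e \<Rightarrow>\<^sub>L real) set)"
  then obtain q a where q: "q \<in> U" "x = (snd c q, a)" by auto
  then have "q \<in> fst c" using U by auto
  then have "x = snd (cotangent_chart Q c) (q, lift_covector Q c q a)"
    "(q, lift_covector Q c q a) \<in> Sigma U (cotangent_space Q)"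
    using q cotangent_chart_lift_same[OF B Q c] lift_covector_in[OF Q c] by auto
  then show "x \<in> snd (cotangent_chart Q c) ` Sigma U (cotangent_space Q)" by blast
qed

lemma cotangent_chart_inv:
  fixes Q :: "('a, 'e::real_normed_vector) atlas" and \<beta> :: "'e \<Rightarrow> 'e \<Rightarrow>\<^sub>L real"
  assumes B: "dual_frame B \<beta>" and Q: "diff_atlas Q" and c: "c \<in> Q" "q \<in> fst c"
  shows "chart_inv (cotangent_chart Q c) (snd c q, a) = (q, lift_covector Q c q a)"
proof -
  have "(q, lift_covector Q c q a) \<in> fst (cotangent_chart Q c)"
    using c lift_covector_in[OF Q c] by (simp add: fst_cotangent_chart)
  then show ?thesis
    using chart_inv_chart[OF cotangent_chart_inj[OF B Q c(1)]] cotangent_chart_lift_same[OF B Q c]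
    by metis
qed

text \<open>The transition is \<open>?F\<close> below: the base transition \<tau> paired with
  precomposition by the derivative of the reverse transition at the image point. Differentiating it
  uses second derivatives of the base atlas.\<close>

lemma cotangent_transition_differentiable:
  fixes Q :: "('a, 'e::real_normed_vector) atlas" and \<beta> :: "'e \<Rightarrow> 'e \<Rightarrow>\<^sub>L real"
  assumes B: "dual_frame B \<beta>" and Q: "smooth_atlas Q" and cd: "c \<in> Q" "d \<in> Q"
    and q: "q \<in> fst c" "q \<in> fst d"
  shows "local_rep (cotangent_chart Q c) (cotangent_chart Q d) id differentiable at (snd c q, a)"
proof -
  have dQ: "diff_atlas Q" using Q by (rule smooth_atlas_imp_diff_atlas)
  let ?\<tau> = "local_rep c d id"
  let ?D = "\<lambda>b x. frechet_derivative (local_rep d c id) (at (?\<tau> x)) b"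
  let ?U = "snd c ` (fst c \<inter> fst d)"
  have \<tau>: "?\<tau> differentiable at (snd c q)"
    using local_rep_has_derivative[OF diff_atlas_id[OF dQ] cd q(1)] q by (auto simp: differentiable_def)
  have \<tau>q: "?\<tau> (snd c r) = snd d r" if "r \<in> fst c" for r
    using that diff_atlas_inj[OF dQ] cd by (simp add: local_rep_def chart_inv_chart)
  have D: "?D b differentiable at (snd c q)" for b
  proof -
    have "smooth_on (snd d ` (fst d \<inter> fst c)) (local_rep d c id)"
      using Q cd unfolding smooth_atlas_def by blast
    then have "(\<lambda>y. frechet_derivative (local_rep d c id) (at y) b) differentiable at (?\<tau> (snd c q))"
      using q \<tau>q by (intro smooth_on_frechet_derivative_differentiable) auto
    from differentiable_chain_at[OF \<tau> this] show ?thesis unfolding o_def .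
  qed
  let ?F = "\<lambda>z :: 'e \<times> ('e \<Rightarrow>\<^sub>L real). (?\<tau> (fst z), \<Sum>b\<in>B. blinfun_apply (snd z) (?D b (fst z)) *\<^sub>R \<beta> b)"
  have fst: "(\<lambda>z. g (fst z)) differentiable at (snd c q, a)" if g: "g differentiable at (snd c q)"
    for g :: "'e \<Rightarrow> 'e"
    using differentiable_chain_at[of fst "(snd c q, a)" g] g
    by (simp add: o_def bounded_linear_imp_differentiable bounded_linear_fst)
  have app: "(\<lambda>z :: 'e \<times> ('e \<Rightarrow>\<^sub>L real). blinfun_apply (snd z) (?D b (fst z))) differentiable at (snd c q, a)" for b
  proof -
    obtain h where "((\<lambda>z. ?D b (fst z)) has_derivative h) (at (snd c q, a))"
      using fst[OF D[of b]] unfolding differentiable_def by blast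
    \<comment> \<open>Product rule for the evaluation pairing of a functional with a vector, both
      varying.\<close>
    from blinfun.FDERIV[OF has_derivative_snd[OF has_derivative_ident] this]
    show ?thesis unfolding differentiable_def by blast
  qed
  have "?F differentiable at (snd c q, a)"
    using B fst[OF \<tau>] app
    by (intro differentiable_Pair differentiable_sum differentiable_scaleR ballI) (auto simp: dual_frame_def)
  then obtain F' where F': "(?F has_derivative F') (at (snd c q, a))"
    unfolding differentiable_def by blast
  have "(local_rep (cotangent_chart Q c) (cotangent_chart Q d) id has_derivative F') (at (snd c q, a))"
  proof (rule has_derivative_transform_within_open[OF F'])
    show "open (?U \<times> (UNIV :: ('e \<Rightarrow>\<^sub>L real) set))"
      using Q cd unfolding smooth_atlas_def by (intro open_Times) auto
    show "(snd c q, a) \<in> ?U \<times> UNIV" using q by auto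
    fix z assume "z \<in> ?U \<times> (UNIV :: ('e \<Rightarrow>\<^sub>L real) set)"
    then obtain r a' where z: "z = (snd c r, a')" "r \<in> fst c" "r \<in> fst d" by auto
    then show "?F z = local_rep (cotangent_chart Q c) (cotangent_chart Q d) id z"
      using cotangent_chart_inv[OF B dQ cd(1), of r a']
        cotangent_chart_lift[OF B dQ cd(1) z(2) cd(2) z(3), of a'] \<tau>q
      by (simp add: local_rep_def[of "cotangent_chart Q c"])
  qed
  then show ?thesis unfolding differentiable_def by blast
qed

lemma diff_atlas_cotangent_bundle:
  fixes Q :: "('a, 'e::real_normed_vector) atlas" and \<beta> :: "'e \<Rightarrow> 'e \<Rightarrow>\<^sub>L real"
  assumes B: "dual_frame B \<beta>" and Q: "smooth_atlas Q"
  shows "diff_atlas (cotangent_bundle Q)"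
proof -
  have dQ: "diff_atlas Q" using Q by (rule smooth_atlas_imp_diff_atlas)
  have "open (snd C ` (fst C \<inter> id -` fst D)) \<and>
      (\<forall>x\<in>snd C ` (fst C \<inter> id -` fst D). local_rep C D id differentiable at x)"
    if CD_in: "C \<in> cotangent_bundle Q" "D \<in> cotangent_bundle Q" for C D
  proof -
    obtain c d where cd: "c \<in> Q" "d \<in> Q" and CD: "C = cotangent_chart Q c" "D = cotangent_chart Q d"
      using CD_in unfolding cotangent_bundle_def by blast
    have "fst C \<inter> id -` fst D = Sigma (fst c \<inter> fst d) (cotangent_space Q)"
      by (auto simp: CD fst_cotangent_chart)
    then have *: "snd C ` (fst C \<inter> id -` fst D) = (snd c ` (fst c \<inter> fst d)) \<times> UNIV"
      using cotangent_chart_image[OF B dQ cd(1), of "fst c \<inter> fst d"] by (simp add: CD)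
    show ?thesis
      unfolding *
      using Q cd cotangent_transition_differentiable[OF B Q cd]
      by (auto simp: CD smooth_atlas_def intro!: open_Times)
  qed
  then show ?thesis
    using cotangent_chart_inj[OF B dQ]
    by (auto simp: diff_atlas_def diff_map_def cotangent_bundle_def)
qed

text \<open>In these charts the projection is the first projection followed by the base
  transition.\<close>

lemma cotangent_proj_has_derivative:
  fixes Q :: "('a, 'e::real_normed_vector) atlas" and \<beta> :: "'e \<Rightarrow> 'e \<Rightarrow>\<^sub>L real"
  assumes B: "dual_frame B \<beta>" and Q: "diff_atlas Q" and cd: "c \<in> Q" "d \<in> Q"
    and q: "q \<in> fst c" "q \<in> fst d"
  shows "(local_rep (cotangent_chart Q c) d cotangent_proj has_derivative local_deriv c d id q \<circ> fst)
    (at (snd c q, a))"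
proof (rule has_derivative_transform_within_open)
  have "(local_rep c d id has_derivative local_deriv c d id q) (at (fst (snd c q, a)))"
    using local_rep_has_derivative[OF diff_atlas_id[OF Q] cd q(1)] q by simp
  then show "(local_rep c d id \<circ> fst has_derivative local_deriv c d id q \<circ> fst) (at (snd c q, a))"
    by (intro diff_chain_at has_derivative_fst has_derivative_ident)
  show "open ((snd c ` fst c) \<times> (UNIV :: ('e \<Rightarrow>\<^sub>L real) set))"
    using diff_atlas_open[OF Q cd(1)] by (intro open_Times) auto
  show "(snd c q, a) \<in> (snd c ` fst c) \<times> UNIV" using q by auto
  fix z assume "z \<in> (snd c ` fst c) \<times> (UNIV :: ('e \<Rightarrow>\<^sub>L real) set)"
  then obtain r a' where "z = (snd c r, a')" "r \<in> fst c" by auto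
  then show "(local_rep c d id \<circ> fst) z = local_rep (cotangent_chart Q c) d cotangent_proj z"
    using cotangent_chart_inv[OF B Q cd(1), of r a'] diff_atlas_inj[OF Q cd(1)]
    by (simp add: local_rep_def cotangent_proj_def chart_inv_chart)
qed

lemma diff_map_cotangent_proj:
  fixes Q :: "('a, 'e::real_normed_vector) atlas" and \<beta> :: "'e \<Rightarrow> 'e \<Rightarrow>\<^sub>L real"
  assumes B: "dual_frame B \<beta>" and Q: "diff_atlas Q"
  shows "diff_map (cotangent_bundle Q) Q cotangent_proj"
  unfolding diff_map_def
proof (rule conjI, goal_cases)
  case 1
  show ?case by (auto simp: points_def cotangent_bundle_def fst_cotangent_chart cotangent_proj_def)
next
  case 2
  have "open (snd C ` (fst C \<inter> cotangent_proj -` fst d)) \<and>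
      (\<forall>x\<in>snd C ` (fst C \<inter> cotangent_proj -` fst d). local_rep C d cotangent_proj differentiable at x)"
    if C_in: "C \<in> cotangent_bundle Q" and d: "d \<in> Q" for C d
  proof -
    obtain c where c: "c \<in> Q" and C: "C = cotangent_chart Q c"
      using C_in unfolding cotangent_bundle_def by blast
    have "fst C \<inter> cotangent_proj -` fst d = Sigma (fst c \<inter> fst d) (cotangent_space Q)"
      by (auto simp: C fst_cotangent_chart cotangent_proj_def)
    then have *: "snd C ` (fst C \<inter> cotangent_proj -` fst d) = (snd c ` (fst c \<inter> fst d)) \<times> UNIV"
      using cotangent_chart_image[OF B Q c, of "fst c \<inter> fst d"] by (simp add: C)
    have "open (snd c ` (fst c \<inter> id -` fst d))"
      using diff_atlas_id[OF Q] c d unfolding diff_map_def by blast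
    moreover have "local_rep C d cotangent_proj differentiable at (snd c q, a)"
      if "q \<in> fst c" "q \<in> fst d" for q a
      using cotangent_proj_has_derivative[OF B Q c d that] unfolding C differentiable_def by blast
    ultimately show ?thesis unfolding * by (auto intro!: open_Times)
  qed
  then show ?case by blast
qed

section \<open>The canonical form and Hamiltonian vector fields\<close>

text \<open>This is \<theta> = p dq: the derivative of the projection forgets the fibre part of
  \<open>w\<close>. It is proved at every point of the chart domain because the exterior derivative
  differentiates it there.\<close>

lemma liouville_form_chart:
  fixes Q :: "('a, 'e::real_normed_vector) atlas" and \<beta> :: "'e \<Rightarrow> 'e \<Rightarrow>\<^sub>L real"
  assumes B: "dual_frame B \<beta>" and Q: "smooth_atlas Q" and c: "c \<in> Q"
    and z: "z \<in> fst (cotangent_chart Q c)"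
  shows "liouville_form Q z (tangent_vector (cotangent_bundle Q) z (cotangent_chart Q c) w)
    = blinfun_apply (snd (snd (cotangent_chart Q c) z)) (fst w)"
proof -
  let ?T = "cotangent_bundle Q" and ?C = "cotangent_chart Q c"
  have dQ: "diff_atlas Q" using Q by (rule smooth_atlas_imp_diff_atlas)
  have dT: "diff_atlas ?T" using diff_atlas_cotangent_bundle[OF B Q] .
  have C: "?C \<in> ?T" using c by (simp add: cotangent_bundle_def)
  have q: "fst z \<in> fst c" "snd z \<in> cotangent_space Q (fst z)" using z by (auto simp: fst_cotangent_chart)
  let ?v = "tangent_vector ?T z ?C w"
  have v: "?v \<in> tangent_space ?T z" "?v ?C = w"
    using tangent_vector_in[OF dT C z] tangent_vector_apply[OF dT C z] by auto
  have "snd (tangent_map ?T Q cotangent_proj (z, ?v)) = tangent_vector Q (fst z) c (fst w)"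
  proof
    fix d
    show "snd (tangent_map ?T Q cotangent_proj (z, ?v)) d = tangent_vector Q (fst z) c (fst w) d"
    proof (cases "d \<in> Q \<and> fst z \<in> fst d")
      case True
      have "snd ?C z = (snd c (fst z), snd (snd ?C z))" by (metis fst_snd_cotangent_chart prod.collapse)
      then have "local_deriv ?C d cotangent_proj z = local_deriv c d id (fst z) \<circ> fst"
        using cotangent_proj_has_derivative[OF B dQ c _ q(1), of d "snd (snd ?C z)"] True
        by (metis frechet_derivative_at)
      then show ?thesis
        using tangent_map_apply[OF dT diff_map_cotangent_proj[OF B dQ] v(1) C _ z, of d] True v(2)
        by (simp add: tangent_vector_def cotangent_proj_def)
    next
      case False
      then show ?thesis
        by (auto simp: tangent_map_def tangent_vector_def cotangent_proj_def)
    qed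
  qed
  then show ?thesis
    using covector_chart_apply[OF B dQ c q(1,2)] by (simp add: liouville_form_def)
qed

text \<open>For fixed \<open>u\<close> the coefficient of \<theta> is linear in the coordinates,
  hence its own derivative; antisymmetrising and the minus sign give
  \<open>phase_form\<close>.\<close>

lemma canonical_form_chart:
  fixes Q :: "('a, 'e::real_normed_vector) atlas" and \<beta> :: "'e \<Rightarrow> 'e \<Rightarrow>\<^sub>L real"
  assumes B: "dual_frame B \<beta>" and Q: "smooth_atlas Q" and z: "z \<in> points (cotangent_bundle Q)"
  shows "canonical_form Q z v w =
    phase_form (v (chart_at (cotangent_bundle Q) z)) (w (chart_at (cotangent_bundle Q) z))"
proof -
  let ?T = "cotangent_bundle Q"
  define C where "C = chart_at ?T z"
  have dQ: "diff_atlas Q" using Q by (rule smooth_atlas_imp_diff_atlas)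
  have dT: "diff_atlas ?T" using diff_atlas_cotangent_bundle[OF B Q] .
  have C: "C \<in> ?T" "z \<in> fst C" using chart_at[OF z] by (auto simp: C_def)
  then obtain c where c: "c \<in> Q" "C = cotangent_chart Q c" unfolding cotangent_bundle_def by blast
  have der: "((\<lambda>x. liouville_form Q (chart_inv C x) (tangent_vector ?T (chart_inv C x) C u))
      has_derivative (\<lambda>v :: 'e \<times> ('e \<Rightarrow>\<^sub>L real). blinfun_apply (snd v) (fst u))) (at (snd C z))" for u
  proof (rule has_derivative_transform_within_open)
    show "((\<lambda>x :: 'e \<times> ('e \<Rightarrow>\<^sub>L real). blinfun_apply (snd x) (fst u)) has_derivative (\<lambda>v. blinfun_apply (snd v) (fst u))) (at (snd C z))"
      by (intro bounded_linear_imp_has_derivative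
          bounded_linear_compose[OF blinfun.bounded_linear_left bounded_linear_snd])
    show "open (snd C ` fst C)" using diff_atlas_open[OF dT C(1)] .
    show "snd C z \<in> snd C ` fst C" using C by auto
    fix x assume "x \<in> snd C ` fst C"
    then obtain y where y: "y \<in> fst C" "x = snd C y" by auto
    then show "blinfun_apply (snd x) (fst u) = liouville_form Q (chart_inv C x) (tangent_vector ?T (chart_inv C x) C u)"
      using liouville_form_chart[OF B Q c(1), of y u] chart_inv_chart[OF diff_atlas_inj[OF dT C(1)]]
      by (simp add: c(2))
  qed
  show ?thesis
    unfolding canonical_form_def exterior_deriv_def Let_def C_def[symmetric] phase_form_def
    by (simp add: frechet_derivative_at[OF der, symmetric])
qed

text \<open>Replaces the definite description by its defining equation in coordinates. Both
  directions serve later: one reads off the equation for \<open>H \<circ> \<epsilon>\<close>, the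
  other recognises a candidate for \<open>H\<close>.\<close>

lemma hamiltonian_vector_field_iff:
  fixes Q :: "('a, 'e::real_normed_vector) atlas" and \<beta> :: "'e \<Rightarrow> 'e \<Rightarrow>\<^sub>L real"
  defines "T \<equiv> cotangent_bundle Q"
  assumes B: "dual_frame B \<beta>" and Q: "smooth_atlas Q" and z: "z \<in> points T"
    and H: "(H \<circ> chart_inv (chart_at T z)) differentiable at (snd (chart_at T z) z)"
  shows "hamiltonian_vector_field Q H z = (z, v) \<longleftrightarrow> v \<in> tangent_space T z \<and>
    (\<forall>w. phase_form (v (chart_at T z)) w =
       frechet_derivative (H \<circ> chart_inv (chart_at T z)) (at (snd (chart_at T z) z)) w)"
proof -
  define C where "C = chart_at T z"
  define \<phi> where "\<phi> = frechet_derivative (H \<circ> chart_inv C) (at (snd C z))"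
  have dT: "diff_atlas T" using diff_atlas_cotangent_bundle[OF B Q] by (simp add: T_def)
  have C: "C \<in> T" "z \<in> fst C" using chart_at[OF z] by (auto simp: C_def)
  have "linear \<phi>" unfolding \<phi>_def C_def using H by (rule linear_frechet_derivative)
  then obtain x where x: "\<And>w. phase_form x w = \<phi> w" using phase_form_represents[OF B] by blast
  define P where "P v \<longleftrightarrow> v \<in> tangent_space T z \<and> (\<forall>w. phase_form (v C) w = \<phi> w)" for v
  have P: "(v \<in> tangent_space T z \<and> (\<forall>w\<in>tangent_space T z. canonical_form Q z v w = differential T H z w))
      \<longleftrightarrow> P v" for v
  proof -
    have "canonical_form Q z v w = phase_form (v C) (w C)" "differential T H z w = \<phi> (w C)" for w
      using canonical_form_chart[OF B Q] z
      by (auto simp: T_def C_def \<phi>_def differential_def Let_def)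
    \<comment> \<open>Evaluation at \<open>C\<close> maps the tangent space onto the model space, so
      testing on tangent vectors is testing on coordinates.\<close>
    moreover have "(\<forall>w\<in>tangent_space T z. phase_form (v C) (w C) = \<phi> (w C))
        \<longleftrightarrow> (\<forall>w. phase_form (v C) w = \<phi> w)"
      using tangent_vector_in[OF dT C] tangent_vector_apply[OF dT C] by metis
    ultimately show ?thesis by (simp add: P_def)
  qed
  have "P (tangent_vector T z C x)"
    using x tangent_vector_in[OF dT C] tangent_vector_apply[OF dT C] by (simp add: P_def)
  moreover have "v = v'" if "P v" "P v'" for v v'
  proof -
    have "phase_form (v C - v' C) w = 0" for w using that by (simp add: P_def phase_form_diff_left del: split_paired_All)
    then have "v C - v' C = 0" by (rule phase_form_nondegenerate[OF B])
    then show ?thesis using that tangent_space_eq[OF C] by (metis P_def eq_iff_diff_eq_0)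
  qed
  ultimately have "(THE v. P v) = v \<longleftrightarrow> P v" by (metis the_equality)
  then have "(z, THE v. P v) = (z, v) \<longleftrightarrow> P v" by simp
  then show ?thesis
    unfolding hamiltonian_vector_field_def T_def[symmetric] C_def[symmetric] \<phi>_def[symmetric] P
    by (simp only: P_def)
qed

text \<open>The image vector pairs with \<open>L w'\<close> as the original pairs with
  \<open>w'\<close>, which by the chain rule is \<open>\<phi> (L w')\<close>. This is the equation
  defining the Hamiltonian vector of \<open>H\<close> at \<open>\<epsilon> z\<close>, tested on the
  range of \<open>L\<close>.\<close>

lemma symplectic_map_hamiltonian_vector_field:
  fixes Q :: "('a, 'e::real_normed_vector) atlas" and \<beta> :: "'e \<Rightarrow> 'e \<Rightarrow>\<^sub>L real"
  defines "T \<equiv> cotangent_bundle Q"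
  assumes B: "dual_frame B \<beta>" and Q: "smooth_atlas Q" and H: "smooth_map T real_line H"
    and \<epsilon>: "symplectic_map Q \<epsilon>" and z: "z \<in> points T"
  shows "tangent_map T T \<epsilon> (hamiltonian_vector_field Q (H \<circ> \<epsilon>) z) = hamiltonian_vector_field Q H (\<epsilon> z)"
proof -
  have dT: "diff_atlas T" using diff_atlas_cotangent_bundle[OF B Q] by (simp add: T_def)
  have d\<epsilon>: "diff_map T T \<epsilon>"
    using smooth_map_imp_diff_map[OF dT dT] \<epsilon> by (simp add: symplectic_map_def T_def)
  have \<epsilon>z: "\<epsilon> z \<in> points T" using diff_map_points[OF d\<epsilon> z] .
  define C where "C = chart_at T z"
  define D where "D = chart_at T (\<epsilon> z)"
  define L where "L = local_deriv C D \<epsilon> z"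
  let ?R = "(UNIV, id) :: (real, real) chart"
  have C: "C \<in> T" "z \<in> fst C" using chart_at[OF z] by (auto simp: C_def)
  have D: "D \<in> T" "\<epsilon> z \<in> fst D" using chart_at[OF \<epsilon>z] by (auto simp: D_def)
  have L: "linear L" unfolding L_def by (rule local_deriv_linear[OF d\<epsilon> C(1) D(1) C(2) D(2)])
  \<comment> \<open>\<open>C\<close> and \<open>D\<close> are the charts of \<open>chart_at\<close>,
    in which the canonical forms at \<open>z\<close> and \<open>\<epsilon> z\<close> are both
    \<open>phase_form\<close>; invariance becomes a statement about \<open>L\<close> alone.\<close>
  have iso: "phase_form (L x) (L y) = phase_form x y" for x y
  proof -
    let ?v = "tangent_vector T z C x" and ?w = "tangent_vector T z C y"
    have vw: "?v \<in> tangent_space T z" "?w \<in> tangent_space T z" "?v C = x" "?w C = y"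
      using tangent_vector_in[OF dT C] tangent_vector_apply[OF dT C] by auto
    have "pullback_form T T \<epsilon> (canonical_form Q) z ?v ?w = canonical_form Q z ?v ?w"
      using \<epsilon> z vw by (simp add: symplectic_map_def T_def)
    then show ?thesis
      using vw canonical_form_chart[OF B Q] z \<epsilon>z
        tangent_map_apply[OF dT d\<epsilon> vw(1) C(1) D(1) C(2) D(2)]
        tangent_map_apply[OF dT d\<epsilon> vw(2) C(1) D(1) C(2) D(2)]
      by (simp add: pullback_form_def T_def[symmetric] C_def[symmetric] D_def[symmetric] L_def[symmetric])
  qed
  have surj: "surj L" using phase_form_isometry_surj[OF B L iso] .
  \<comment> \<open>The real line has the coordinate \<open>id\<close>, so a local representative is
    the expression inside \<open>differential\<close>, and the chain rule for local representatives
    applies to \<open>H\<close>.\<close>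
  have rep: "local_rep E ?R f = f \<circ> chart_inv E" for E :: "(('a, 'e) covector, 'e \<times> ('e \<Rightarrow>\<^sub>L real)) chart" and f
    by (simp add: local_rep_def)
  have dH: "(H \<circ> chart_inv D) differentiable at (snd D (\<epsilon> z))"
  proof -
    have "smooth_on (snd D ` (fst D \<inter> H -` fst ?R)) (local_rep D ?R H)"
      using H D unfolding smooth_map_def real_line_def by blast
    then show ?thesis using D by (auto simp: rep intro: smooth_on_differentiable)
  qed
  define \<phi> where "\<phi> = frechet_derivative (H \<circ> chart_inv D) (at (snd D (\<epsilon> z)))"
  have "((H \<circ> \<epsilon>) \<circ> chart_inv C has_derivative \<phi> \<circ> L) (at (snd C z))"
    using local_rep_comp_has_derivative[OF dT dT d\<epsilon> C(1) D(1) C(2) D(2), of ?R H \<phi>] dH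
    by (simp add: rep L_def \<phi>_def frechet_derivative_works)
  then have dH\<epsilon>: "((H \<circ> \<epsilon>) \<circ> chart_inv C) differentiable at (snd C z)"
    "frechet_derivative ((H \<circ> \<epsilon>) \<circ> chart_inv C) (at (snd C z)) = \<phi> \<circ> L"
    by (auto simp only: differentiable_def frechet_derivative_at[symmetric])
  obtain v where v: "hamiltonian_vector_field Q (H \<circ> \<epsilon>) z = (z, v)"
    by (simp add: hamiltonian_vector_field_def)
  have "v \<in> tangent_space T z \<and> (\<forall>w. phase_form (v C) w = (\<phi> \<circ> L) w)"
    using hamiltonian_vector_field_iff[OF B Q, of z "H \<circ> \<epsilon>" v, folded T_def, folded C_def, OF z dH\<epsilon>(1)] v
    by (simp only: dH\<epsilon>(2) simp_thms)
  then have v': "v \<in> tangent_space T z" "\<And>w. phase_form (v C) w = \<phi> (L w)"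
    by (simp_all del: split_paired_All)
  let ?u = "snd (tangent_map T T \<epsilon> (z, v))"
  have u: "?u \<in> tangent_space T (\<epsilon> z)" "?u D = L (v C)"
    using tangent_map_in[OF dT dT d\<epsilon> z] tangent_map_apply[OF dT d\<epsilon> v'(1) C(1) D(1) C(2) D(2)]
    by (auto simp: L_def)
  have "phase_form (?u D) w = \<phi> w" for w
  proof -
    \<comment> \<open>Surjectivity turns the equation on the range of \<open>L\<close> into one for
      all test vectors.\<close>
    obtain w' where "w = L w'" using surj by (meson surjD)
    then show ?thesis using u v' iso by simp
  qed
  then have "hamiltonian_vector_field Q H (\<epsilon> z) = (\<epsilon> z, ?u)"
    using hamiltonian_vector_field_iff[OF B Q, of "\<epsilon> z" H ?u] u \<epsilon>z dH
    by (simp add: T_def[symmetric] D_def[symmetric] \<phi>_def)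
  then show ?thesis by (simp add: v tangent_map_def)
qed

theorem theorem2p6:
  fixes Q :: "('a, 'e::real_normed_vector) atlas"
    and H :: "('a, 'e) covector \<Rightarrow> real"
    and \<gamma> :: "'a \<Rightarrow> ('a, 'e) covector"
    and lam \<epsilon> :: "('a, 'e) covector \<Rightarrow> ('a, 'e) covector"
    and X_H_\<epsilon> :: "('a, 'e) covector \<Rightarrow> 'a \<times> ('a, 'e) tangent"
  assumes Q: "smooth_manifold Q"
    and H: "smooth_map (cotangent_bundle Q) real_line H"
    and \<gamma>: "one_form Q \<gamma>"
    and lam: "lam = \<gamma> \<circ> cotangent_proj"
    and \<epsilon>: "symplectic_map Q \<epsilon>"
    and X_H_\<epsilon>: "X_H_\<epsilon> = tangent_map (cotangent_bundle Q) Q cotangent_proj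
                          \<circ> hamiltonian_vector_field Q H \<circ> \<epsilon>"
  shows "(\<forall>z\<in>points (cotangent_bundle Q).
            tangent_map (cotangent_bundle Q) (cotangent_bundle Q) \<epsilon>
              (hamiltonian_vector_field Q (H \<circ> \<epsilon>) z)
            = tangent_map (cotangent_bundle Q) (cotangent_bundle Q) lam
                (hamiltonian_vector_field Q H (\<epsilon> z)))
         \<longleftrightarrow>
         (\<forall>z\<in>points (cotangent_bundle Q).
            tangent_map Q (cotangent_bundle Q) \<gamma> (X_H_\<epsilon> z)
            = hamiltonian_vector_field Q H (\<epsilon> z))"
proof -
  let ?T = "cotangent_bundle Q"
  have sQ: "smooth_atlas Q" using Q by (simp add: smooth_manifold_def)
  obtain B and \<beta> :: "'e \<Rightarrow> 'e \<Rightarrow>\<^sub>L real" where B: "dual_frame B \<beta>"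
    using smooth_manifold_dual_frame[OF Q] by blast
  have dQ: "diff_atlas Q" using sQ by (rule smooth_atlas_imp_diff_atlas)
  have dT: "diff_atlas ?T" using diff_atlas_cotangent_bundle[OF B sQ] .
  have d\<epsilon>: "diff_map ?T ?T \<epsilon>" and d\<gamma>: "diff_map Q ?T \<gamma>"
    using smooth_map_imp_diff_map[OF dT dT] smooth_map_imp_diff_map[OF dQ dT] \<epsilon> \<gamma>
    by (auto simp: symplectic_map_def one_form_def)
  have "tangent_map ?T ?T lam (hamiltonian_vector_field Q H (\<epsilon> z)) = tangent_map Q ?T \<gamma> (X_H_\<epsilon> z)"
    if "z \<in> points ?T" for z
  proof -
    \<comment> \<open>The base point is explicit in the definition, and it is all that the chain
      rule asks about.\<close>
    have "fst (hamiltonian_vector_field Q H (\<epsilon> z)) \<in> points ?T"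
      using diff_map_points[OF d\<epsilon> that] by (simp add: hamiltonian_vector_field_def)
    then show ?thesis
      using tangent_map_comp[OF dT dQ diff_map_cotangent_proj[OF B dQ] d\<gamma>] by (simp add: lam X_H_\<epsilon>)
  qed
  then show ?thesis
    \<comment> \<open>The first equation now has the Hamiltonian vector on its left, the second on
      its right, hence the swap of sides.\<close>
    using symplectic_map_hamiltonian_vector_field[OF B sQ H \<epsilon>] by (auto simp: eq_commute)
qed

end
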